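(* Let $(X,b)$ be a connected weighted graph satisfying a global Poincaré inequality, i.e. there is $c>0$ with $\|f\|_{\mathcal V}^2\le c\,\mathcal E(f)$ for all $f\in\mathcal D$, and let $m$ be a probability measure on $X$ of full support. Then $H_m^{(N)}$ has pure point spectrum.
   Context: A weighted graph $(X,b)$ consists of a nonempty countable (finite or infinite) set $X$ and a symmetric function $b:X\times X\to[0,\infty)$ with $b(x,x)=0$ for all $x\in X$ (no summability or local finiteness is assumed). It is connected if for any $x,y\in X$ there are $x=x_0,x_1,\dots,x_k=y$ with $b(x_j,x_{j+1})>0$ for $0\le j<k$. Let $\mathcal D=\{f:X\to\mathbb R\mid \sum_{x,y\in X}b(x,y)|f(x)-f(y)|^2<\infty\}$ and $\mathcal E(f,g)=\frac12\sum_{x,y\in X}b(x,y)(f(x)-f(y))(g(x)-g(y))$, $\mathcal E(f)=\mathcal E(f,f)$. For $f:X\to\mathbb R$ put $\|f\|_{\mathcal V}=\sup f-\inf f\in[0,\infty]$. Full support means $m(x):=m(\{x\})>0$ for all $x\in X$; $\ell^2(X,m)=\{f:X\to\mathbb R\mid\|f\|_2^2=\sum_x|f(x)|^2m(x)<\infty\}$. $\mathcal E^{(N)}$ is the restriction of $\mathcal E$ to $\mathcal D\cap\ell^2(X,m)$, a closed (not necessarily densely defined) form on $\ell^2(X,m)$; $H_m^{(N)}$ is the associated nonnegative selfadjoint operator in the closure of $\mathcal D\cap\ell^2(X,m)$ in $\ell^2(X,m)$. Pure point spectrum means that this Hilbert space has an orthonormal basis of eigenvectors of $H_m^{(N)}$.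 *)

theory Defs
  imports "HOL-Probability.Probability"
begin

text \<open>The vertex set is the universe of a countable type: nonempty, and finite or infinite.\<close>

locale weighted_graph =
  fixes b :: "'a::countable \<Rightarrow> 'a \<Rightarrow> real"
  assumes symmetric: "b x y = b y x"
    and nonneg: "0 \<le> b x y"
    and no_loops: "b x x = 0"

definition graph_connected :: "('a::countable \<Rightarrow> 'a \<Rightarrow> real) \<Rightarrow> bool" where
  "graph_connected b \<longleftrightarrow> (\<forall>x y. (\<lambda>u v. b u v > 0)\<^sup>*\<^sup>* x y)"

definition energy_space :: "('a::countable \<Rightarrow> 'a \<Rightarrow> real) \<Rightarrow> ('a \<Rightarrow> real) set" where
  "energy_space b = {f. (\<lambda>(x, y). b x y * \<bar>f x - f y\<bar>\<^sup>2) summable_on UNIV}"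

definition energy :: "('a::countable \<Rightarrow> 'a \<Rightarrow> real) \<Rightarrow> ('a \<Rightarrow> real) \<Rightarrow> ('a \<Rightarrow> real) \<Rightarrow> real" where
  "energy b f g = 1 / 2 * (\<Sum>\<^sub>\<infinity>(x, y)\<in>UNIV. b x y * (f x - f y) * (g x - g y))"

definition variation_norm :: "('a::countable \<Rightarrow> real) \<Rightarrow> ereal" where
  "variation_norm f = (SUP x. ereal (f x)) - (INF x. ereal (f x))"

definition global_poincare :: "('a::countable \<Rightarrow> 'a \<Rightarrow> real) \<Rightarrow> bool" where
  "global_poincare b \<longleftrightarrow>
     (\<exists>c>0. \<forall>f\<in>energy_space b. (variation_norm f)\<^sup>2 \<le> ereal (c * energy b f f))"

definition full_support :: "'a::countable measure \<Rightarrow> bool" where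
  "full_support m \<longleftrightarrow> (\<forall>x. measure m {x} > 0)"

text \<open>Since all point masses are positive, the elements of $\ell^2(X,m)$ are genuine functions
  and no quotient by null functions is needed.\<close>

definition ell2 :: "'a::countable measure \<Rightarrow> ('a \<Rightarrow> real) set" where
  "ell2 m = {f. (\<lambda>x. \<bar>f x\<bar>\<^sup>2 * measure m {x}) summable_on UNIV}"

definition ell2_inner :: "'a::countable measure \<Rightarrow> ('a \<Rightarrow> real) \<Rightarrow> ('a \<Rightarrow> real) \<Rightarrow> real" where
  "ell2_inner m f g = (\<Sum>\<^sub>\<infinity>x\<in>UNIV. f x * g x * measure m {x})"

definition ell2_norm :: "'a::countable measure \<Rightarrow> ('a \<Rightarrow> real) \<Rightarrow> real" where
  "ell2_norm m f = sqrt (ell2_inner m f f)"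

definition ell2_closure :: "'a::countable measure \<Rightarrow> ('a \<Rightarrow> real) set \<Rightarrow> ('a \<Rightarrow> real) set" where
  "ell2_closure m S = {f \<in> ell2 m. \<forall>e>0. \<exists>g\<in>S. ell2_norm m (\<lambda>x. f x - g x) < e}"

text \<open>The operator associated with a form \<open>q\<close> with domain \<open>D\<close>, acting in the closure of \<open>D\<close>
  (first representation theorem): \<open>H f = g\<close> iff \<open>q f h = \<langle>g, h\<rangle>\<close> for all \<open>h \<in> D\<close>.
  Uniqueness of \<open>g\<close> is the lemma \<open>form_represents_unique\<close> below.\<close>

definition form_represents ::
  "'a::countable measure \<Rightarrow> ('a \<Rightarrow> real) set \<Rightarrow> (('a \<Rightarrow> real) \<Rightarrow> ('a \<Rightarrow> real) \<Rightarrow> real)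
     \<Rightarrow> ('a \<Rightarrow> real) \<Rightarrow> ('a \<Rightarrow> real) \<Rightarrow> bool" where
  "form_represents m D q f g \<longleftrightarrow>
     f \<in> D \<and> g \<in> ell2_closure m D \<and> (\<forall>h\<in>D. q f h = ell2_inner m g h)"

definition form_op_dom ::
  "'a::countable measure \<Rightarrow> ('a \<Rightarrow> real) set \<Rightarrow> (('a \<Rightarrow> real) \<Rightarrow> ('a \<Rightarrow> real) \<Rightarrow> real)
     \<Rightarrow> ('a \<Rightarrow> real) set" where
  "form_op_dom m D q = {f. \<exists>g. form_represents m D q f g}"

definition form_op ::
  "'a::countable measure \<Rightarrow> ('a \<Rightarrow> real) set \<Rightarrow> (('a \<Rightarrow> real) \<Rightarrow> ('a \<Rightarrow> real) \<Rightarrow> real)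
     \<Rightarrow> ('a \<Rightarrow> real) \<Rightarrow> ('a \<Rightarrow> real)" where
  "form_op m D q f = (THE g. form_represents m D q f g)"

definition eigenvector ::
  "('a \<Rightarrow> real) set \<Rightarrow> (('a \<Rightarrow> real) \<Rightarrow> ('a \<Rightarrow> real)) \<Rightarrow> ('a \<Rightarrow> real) \<Rightarrow> bool" where
  "eigenvector domH H f \<longleftrightarrow> f \<in> domH \<and> f \<noteq> (\<lambda>x. 0) \<and> (\<exists>l. H f = (\<lambda>x. l * f x))"

definition ell2_orthonormal :: "'a::countable measure \<Rightarrow> ('a \<Rightarrow> real) set \<Rightarrow> bool" where
  "ell2_orthonormal m B \<longleftrightarrow>
     (\<forall>f\<in>B. \<forall>g\<in>B. ell2_inner m f g = (if f = g then 1 else 0))"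

definition lin_span :: "('a \<Rightarrow> real) set \<Rightarrow> ('a \<Rightarrow> real) set" where
  "lin_span B = {(\<lambda>x. \<Sum>g\<in>F. a g * g x) | F a. finite F \<and> F \<subseteq> B}"

definition ell2_orthonormal_basis ::
  "'a::countable measure \<Rightarrow> ('a \<Rightarrow> real) set \<Rightarrow> ('a \<Rightarrow> real) set \<Rightarrow> bool" where
  "ell2_orthonormal_basis m K B \<longleftrightarrow>
     B \<subseteq> K \<and> ell2_orthonormal m B \<and> K = ell2_closure m (lin_span B)"

definition pure_point_spectrum ::
  "'a::countable measure \<Rightarrow> ('a \<Rightarrow> real) set \<Rightarrow> ('a \<Rightarrow> real) set
     \<Rightarrow> (('a \<Rightarrow> real) \<Rightarrow> ('a \<Rightarrow> real)) \<Rightarrow> bool" where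
  "pure_point_spectrum m K domH H \<longleftrightarrow>
     (\<exists>B. ell2_orthonormal_basis m K B \<and> (\<forall>f\<in>B. eigenvector domH H f))"

text \<open>The form $\mathcal{E}^{(N)}$ is \<open>energy b\<close> with domain \<open>neumann_form_dom b m\<close>.\<close>

definition neumann_form_dom ::
  "('a::countable \<Rightarrow> 'a \<Rightarrow> real) \<Rightarrow> 'a measure \<Rightarrow> ('a \<Rightarrow> real) set" where
  "neumann_form_dom b m = energy_space b \<inter> ell2 m"

definition neumann_space ::
  "('a::countable \<Rightarrow> 'a \<Rightarrow> real) \<Rightarrow> 'a measure \<Rightarrow> ('a \<Rightarrow> real) set" where
  "neumann_space b m = ell2_closure m (neumann_form_dom b m)"

definition neumann_dom ::
  "('a::countable \<Rightarrow> 'a \<Rightarrow> real) \<Rightarrow> 'a measure \<Rightarrow> ('a \<Rightarrow> real) set" where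
  "neumann_dom b m = form_op_dom m (neumann_form_dom b m) (energy b)"

definition neumann_op ::
  "('a::countable \<Rightarrow> 'a \<Rightarrow> real) \<Rightarrow> 'a measure \<Rightarrow> ('a \<Rightarrow> real) \<Rightarrow> ('a \<Rightarrow> real)" where
  "neumann_op b m = form_op m (neumann_form_dom b m) (energy b)"

lemma summable_on_real_diff:
  fixes f g :: "'b \<Rightarrow> real"
  assumes "f summable_on A" "g summable_on A"
  shows "(\<lambda>x. f x - g x) summable_on A"
  using summable_on_add[OF assms(1), of "\<lambda>x. - g x"] assms(2) by (simp add: summable_on_uminus)

lemma infsum_real_diff:
  fixes f g :: "'b \<Rightarrow> real"
  assumes "f summable_on A" "g summable_on A"
  shows "infsum (\<lambda>x. f x - g x) A = infsum f A - infsum g A"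
  using infsum_add[OF assms(1), of "\<lambda>x. - g x"] assms(2)
  by (simp add: summable_on_uminus infsum_uminus)

lemma ell2_mult_summable:
  assumes "f \<in> ell2 m" "g \<in> ell2 m"
  shows "(\<lambda>x. f x * g x * measure m {x}) summable_on UNIV"
proof -
  have s: "(\<lambda>x. (f x)\<^sup>2 * measure m {x} + (g x)\<^sup>2 * measure m {x}) summable_on UNIV"
    using assms by (intro summable_on_add) (auto simp: ell2_def)
  have le: "\<bar>u * v\<bar> \<le> u\<^sup>2 + v\<^sup>2" for u v :: real
  proof -
    have "2 * (\<bar>u\<bar> * \<bar>v\<bar>) \<le> u\<^sup>2 + v\<^sup>2"
      using sum_squares_bound[of "\<bar>u\<bar>" "\<bar>v\<bar>"] by (simp add: mult.assoc)
    moreover have "0 \<le> \<bar>u\<bar> * \<bar>v\<bar>" by simp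
    ultimately show ?thesis unfolding abs_mult by linarith
  qed
  have "norm (f x * g x * measure m {x}) \<le> (f x)\<^sup>2 * measure m {x} + (g x)\<^sup>2 * measure m {x}" for x
    using mult_right_mono[OF le[of "f x" "g x"], of "measure m {x}"]
    by (simp add: abs_mult algebra_simps)
  then have "(\<lambda>x. norm (f x * g x * measure m {x})) summable_on UNIV"
    by (intro summable_on_comparison_test[OF s]) auto
  then show ?thesis
    by (rule abs_summable_summable)
qed

lemma ell2_diff:
  assumes "f \<in> ell2 m" "g \<in> ell2 m"
  shows "(\<lambda>x. f x - g x) \<in> ell2 m"
proof -
  have "(\<lambda>x. (f x * f x * measure m {x} - f x * g x * measure m {x})
            - (f x * g x * measure m {x} - g x * g x * measure m {x})) summable_on UNIV"
    using assms by (intro summable_on_real_diff ell2_mult_summable)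
  then show ?thesis
    by (simp add: ell2_def power2_eq_square algebra_simps)
qed

lemma ell2_inner_diff:
  assumes "f \<in> ell2 m" "g \<in> ell2 m" "h \<in> ell2 m"
  shows "ell2_inner m h (\<lambda>x. f x - g x) = ell2_inner m h f - ell2_inner m h g"
    and "ell2_inner m (\<lambda>x. f x - g x) h = ell2_inner m f h - ell2_inner m g h"
  using assms by (simp_all add: ell2_inner_def left_diff_distrib right_diff_distrib
      infsum_real_diff ell2_mult_summable)

lemma ell2_inner_bound:
  assumes "u \<in> ell2 m" "w \<in> ell2 m" "ell2_norm m w < e" "e > 0"
  shows "\<bar>ell2_inner m u w\<bar> \<le> e * (ell2_inner m u u + 1)"
proof -
  let ?s = "\<lambda>x. e * (u x * u x * measure m {x}) + (1 / e) * (w x * w x * measure m {x})"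
  have su: "(\<lambda>x. u x * u x * measure m {x}) summable_on UNIV"
    and sw: "(\<lambda>x. w x * w x * measure m {x}) summable_on UNIV"
    and suw: "(\<lambda>x. u x * w x * measure m {x}) summable_on UNIV"
    using assms by (auto intro: ell2_mult_summable)
  have ss: "?s summable_on UNIV"
    using su sw by (intro summable_on_add summable_on_cmult_right)
  have le: "\<bar>p * q\<bar> \<le> e * (p * p) + (1 / e) * (q * q)" for p q :: real
  proof -
    have "2 * (e * \<bar>p\<bar>) * \<bar>q\<bar> \<le> (e * \<bar>p\<bar>)\<^sup>2 + \<bar>q\<bar>\<^sup>2"
      by (rule sum_squares_bound)
    then have "2 * (e * \<bar>p * q\<bar>) \<le> e * (e * (p * p) + (1 / e) * (q * q))"
      using assms(4) by (simp add: power2_eq_square abs_mult algebra_simps)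
    moreover have "0 \<le> e * \<bar>p * q\<bar>"
      using assms(4) by simp
    ultimately have "e * \<bar>p * q\<bar> \<le> e * (e * (p * p) + (1 / e) * (q * q))"
      by linarith
    then show ?thesis
      using assms(4) by (simp only: mult_le_cancel_left_pos)
  qed
  have pt: "\<bar>u x * w x * measure m {x}\<bar> \<le> ?s x" for x
    using mult_right_mono[OF le[of "u x" "w x"], of "measure m {x}"]
    by (simp add: abs_mult algebra_simps)
  have "ell2_inner m u w \<le> infsum ?s UNIV"
    unfolding ell2_inner_def by (rule infsum_mono[OF suw ss]) (rule abs_le_D1[OF pt])
  moreover have "infsum (\<lambda>x. - (u x * w x * measure m {x})) UNIV \<le> infsum ?s UNIV"
    by (rule infsum_mono[OF _ ss]) (use suw in \<open>simp add: summable_on_uminus\<close>, rule abs_le_D2[OF pt])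
  then have "- ell2_inner m u w \<le> infsum ?s UNIV"
    unfolding ell2_inner_def infsum_uminus .
  moreover have "infsum ?s UNIV = e * ell2_inner m u u + (1 / e) * ell2_inner m w w"
    unfolding ell2_inner_def
    by (simp only: infsum_add[OF summable_on_cmult_right[OF su] summable_on_cmult_right[OF sw]]
        infsum_cmult_right')
  moreover have "ell2_inner m w w \<le> e * e"
  proof -
    have "ell2_norm m w \<le> e" using assms(3) by simp
    then have "ell2_inner m w w \<le> e\<^sup>2"
      unfolding ell2_norm_def by (rule sqrt_le_D)
    then show ?thesis by (simp add: power2_eq_square)
  qed
  then have "(1 / e) * ell2_inner m w w \<le> e"
    using assms(4) by (simp add: field_simps)
  ultimately show ?thesis
    by (simp add: algebra_simps)
qed

lemma form_represents_unique:
  assumes m: "full_support m" and D: "D \<subseteq> ell2 m"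
    and g: "form_represents m D q f g" and g': "form_represents m D q f g'"
  shows "g = g'"
proof -
  define u where "u = (\<lambda>x. g x - g' x)"
  let ?N = "ell2_inner m u u"
  have gl: "g \<in> ell2 m" "g' \<in> ell2 m"
    using g g' by (auto simp: form_represents_def ell2_closure_def)
  have ul: "u \<in> ell2 m"
    unfolding u_def by (rule ell2_diff[OF gl])
  have orth: "ell2_inner m u h = 0" if "h \<in> D" for h
    using that g g' D gl by (auto simp: u_def form_represents_def ell2_inner_diff subset_iff)
  have small: "\<bar>ell2_inner m u k\<bar> \<le> e * (?N + 1)" if k: "k \<in> ell2_closure m D" and e: "e > 0" for k e
  proof -
    obtain h where h: "h \<in> D" "ell2_norm m (\<lambda>x. k x - h x) < e"
      using k e by (auto simp: ell2_closure_def)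
    have kl: "k \<in> ell2 m" "h \<in> ell2 m"
      using k h D by (auto simp: ell2_closure_def)
    have "\<bar>ell2_inner m u (\<lambda>x. k x - h x)\<bar> \<le> e * (?N + 1)"
      by (rule ell2_inner_bound[OF ul ell2_diff[OF kl] h(2) e])
    then show ?thesis
      by (simp add: ell2_inner_diff(1)[OF kl ul] orth[OF h(1)])
  qed
  have zero: "ell2_inner m u k = 0" if k: "k \<in> ell2_closure m D" for k
  proof (rule ccontr)
    assume "ell2_inner m u k \<noteq> 0"
    moreover have N: "?N \<ge> 0"
      unfolding ell2_inner_def by (intro infsum_nonneg) auto
    ultimately have "\<bar>ell2_inner m u k\<bar> / (2 * (?N + 1)) > 0"
      by auto
    from small[OF k this] have "\<bar>ell2_inner m u k\<bar> \<le> \<bar>ell2_inner m u k\<bar> / (2 * (?N + 1)) * (?N + 1)" .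
    also have "\<dots> = \<bar>ell2_inner m u k\<bar> / 2"
      using N by (simp add: field_simps)
    finally show False
      using \<open>ell2_inner m u k \<noteq> 0\<close> by linarith
  qed
  have "ell2_inner m u g = 0" "ell2_inner m u g' = 0"
    using g g' by (auto simp: form_represents_def intro: zero)
  then have "?N = 0"
    using ell2_inner_diff(1)[OF gl ul] by (simp add: u_def)
  moreover have "(\<lambda>x. u x * u x * measure m {x}) summable_on UNIV"
    by (rule ell2_mult_summable[OF ul ul])
  ultimately have "u x * u x * measure m {x} = 0" for x
    unfolding ell2_inner_def by (intro nonneg_infsum_le_0D[of _ UNIV]) auto
  moreover have "measure m {x} \<noteq> 0" for x
    using m unfolding full_support_def by (metis less_irrefl)
  ultimately have "u x = 0" for x
    by (metis mult_eq_0_iff)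
  then show ?thesis
    by (auto simp: u_def fun_eq_iff)
qed

end

theory Submission
  imports Defs "HOL-Complex_Analysis.Great_Picard"
begin

text \<open>By the Poincare inequality, a function of finite energy is bounded in terms of its energy and
  its value at one fixed vertex. As \<open>m\<close> is finite, form-bounded sequences therefore have
  subsequences converging pointwise with a uniform bound, hence in $\ell^2(X,m)$: the form domain is
  compactly embedded. Given a maximal orthonormal set \<open>B\<close> of eigenvectors, minimising the Rayleigh
  quotient over the orthogonal complement of \<open>B\<close> in the form domain would produce a further
  eigenvector, so this complement is zero and \<open>B\<close> spans a dense subspace.\<close>

section \<open>Weighted square-summable functions\<close>

text \<open>A minimiser over the complement of \<open>B\<close> satisfies its Euler equation against
  test vectors from that complement, whereas an eigenvector must satisfy it against the whole form
  domain. For infinite \<open>B\<close> the projection of a test vector is reached only as a limit,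
  along which the form is merely lower semicontinuous. Test vectors are therefore replaced by
  approximate projections that leave all pairings with the complement unchanged and never increase
  either form; an upper bound on the energy is then enough for the first-variation argument.
  Constants have zero energy, so the Poincare inequality cannot bound them; the l2 norm does so
  through the mass of the fixed vertex. The functional-analytic half concerns an abstract pair of
  forms, with compactness and lower semicontinuity taking the place of completeness.\<close>

definition wl2 :: "('i \<Rightarrow> real) \<Rightarrow> ('i \<Rightarrow> real) set" where
  "wl2 w = {f. (\<lambda>i. (f i)\<^sup>2 * w i) summable_on UNIV}"

text \<open>Used with two weights: point masses on vertices, giving the inner product of l2, and
  \<open>b\<close> on ordered pairs, where the product of two gradients is twice the energy.\<close>

definition wl2_inner :: "('i \<Rightarrow> real) \<Rightarrow> ('i \<Rightarrow> real) \<Rightarrow> ('i \<Rightarrow> real) \<Rightarrow> real" where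
  "wl2_inner w f g = (\<Sum>\<^sub>\<infinity>i. f i * g i * w i)"

lemma wl2_mult_summable:
  assumes w: "\<And>i. 0 \<le> w i" and f: "f \<in> wl2 w" and g: "g \<in> wl2 w"
  shows "(\<lambda>i. f i * g i * w i) summable_on UNIV"
proof -
  have s: "(\<lambda>i. (f i)\<^sup>2 * w i + (g i)\<^sup>2 * w i) summable_on UNIV"
    using f g by (intro summable_on_add) (auto simp: wl2_def)
  have le: "\<bar>u * v\<bar> \<le> u\<^sup>2 + v\<^sup>2" for u v :: real
    using sum_squares_bound[of "\<bar>u\<bar>" "\<bar>v\<bar>"] abs_ge_zero[of "u * v"]
    by (simp only: abs_mult power2_abs mult.assoc)
  have "norm (f i * g i * w i) \<le> (f i)\<^sup>2 * w i + (g i)\<^sup>2 * w i" for i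
    using mult_right_mono[OF le[of "f i" "g i"] w[of i]] w[of i]
    by (simp add: abs_mult algebra_simps)
  then have "(\<lambda>i. norm (f i * g i * w i)) summable_on UNIV"
    by (intro summable_on_comparison_test[OF s]) auto
  then show ?thesis
    by (rule abs_summable_summable)
qed

lemma wl2_lincomb:
  assumes w: "\<And>i. 0 \<le> w i" and f: "f \<in> wl2 w" and g: "g \<in> wl2 w"
  shows "(\<lambda>i. s * f i + t * g i) \<in> wl2 w"
proof -
  have "(\<lambda>i. s\<^sup>2 * ((f i)\<^sup>2 * w i) + (2 * s * t) * (f i * g i * w i) + t\<^sup>2 * ((g i)\<^sup>2 * w i))
    summable_on UNIV"
    using f g wl2_mult_summable[OF w f g]
    by (intro summable_on_add summable_on_cmult_right) (auto simp: wl2_def)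
  then show ?thesis
    by (simp add: wl2_def power2_eq_square algebra_simps)
qed

lemma wl2_inner_sym: "wl2_inner w f g = wl2_inner w g f"
  by (simp add: wl2_inner_def mult.commute mult.left_commute)

lemma wl2_inner_lincomb:
  assumes w: "\<And>i. 0 \<le> w i" and f: "f \<in> wl2 w" and g: "g \<in> wl2 w" and h: "h \<in> wl2 w"
  shows "wl2_inner w (\<lambda>i. s * f i + t * g i) h = s * wl2_inner w f h + t * wl2_inner w g h"
proof -
  have "wl2_inner w (\<lambda>i. s * f i + t * g i) h =
      (\<Sum>\<^sub>\<infinity>i. s * (f i * h i * w i) + t * (g i * h i * w i))"
    by (simp add: wl2_inner_def algebra_simps)
  also have "\<dots> = (\<Sum>\<^sub>\<infinity>i. s * (f i * h i * w i)) + (\<Sum>\<^sub>\<infinity>i. t * (g i * h i * w i))"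
    by (intro infsum_add summable_on_cmult_right wl2_mult_summable assms)
  finally show ?thesis
    by (simp add: wl2_inner_def infsum_cmult_right')
qed

lemma wl2_inner_self_nonneg:
  assumes "\<And>i. 0 \<le> w i"
  shows "0 \<le> wl2_inner w f f"
  unfolding wl2_inner_def using assms by (intro infsum_nonneg) auto

lemma wl2_inner_ge_term:
  assumes w: "\<And>i. 0 \<le> w i" and f: "f \<in> wl2 w"
  shows "(f i)\<^sup>2 * w i \<le> wl2_inner w f f"
  using finite_sum_le_infsum[OF wl2_mult_summable[OF w f f], of "{i}"] w
  by (simp add: wl2_inner_def power2_eq_square)

text \<open>Finite partial sums pass to the limit and keep the bound \<open>C\<close>, and a
  nonnegative sum is the supremum of its finite partial sums. Membership of the limit is part of the
  conclusion, so this yields closedness as well as lower semicontinuity.\<close>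

lemma wl2_fatou:
  assumes w: "\<And>i. 0 \<le> w i" and f: "\<And>n. f n \<in> wl2 w" and le: "\<And>n. wl2_inner w (f n) (f n) \<le> C"
    and lim: "\<And>i. (\<lambda>n. f n i) \<longlonglongrightarrow> g i"
  shows "g \<in> wl2 w" and "wl2_inner w g g \<le> C"
proof -
  have fin: "(\<Sum>i\<in>F. g i * g i * w i) \<le> C" if "finite F" for F
  proof (rule LIMSEQ_le_const2)
    show "(\<lambda>n. \<Sum>i\<in>F. f n i * f n i * w i) \<longlonglongrightarrow> (\<Sum>i\<in>F. g i * g i * w i)"
      by (intro tendsto_sum tendsto_mult lim tendsto_const)
    have "(\<Sum>i\<in>F. f n i * f n i * w i) \<le> C" for n
      using finite_sum_le_infsum[OF wl2_mult_summable[OF w f f] that, of n n] le[of n] w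
      by (auto simp: wl2_inner_def intro: order.trans)
    then show "\<exists>N. \<forall>n\<ge>N. (\<Sum>i\<in>F. f n i * f n i * w i) \<le> C"
      by blast
  qed
  have s: "(\<lambda>i. g i * g i * w i) summable_on UNIV"
    using fin w by (intro nonneg_bdd_above_summable_on bdd_aboveI2[where M = C]) auto
  then show "g \<in> wl2 w"
    by (simp add: wl2_def power2_eq_square)
  show "wl2_inner w g g \<le> C"
    unfolding wl2_inner_def using fin by (intro infsum_le_finite_sums[OF s]) auto
qed

text \<open>Dominated convergence for counting measure, transported from integrals to unordered
  sums.\<close>

lemma infsum_tendsto_0_dominated:
  fixes f :: "nat \<Rightarrow> 'i::countable \<Rightarrow> real"
  assumes h: "h summable_on UNIV" and le: "\<And>n i. \<bar>f n i\<bar> \<le> h i"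
    and lim: "\<And>i. (\<lambda>n. f n i) \<longlonglongrightarrow> 0"
  shows "(\<lambda>n. \<Sum>\<^sub>\<infinity>i. f n i) \<longlonglongrightarrow> 0"
proof -
  have h0: "0 \<le> h i" for i
    using le[of undefined i] by linarith
  have ih: "integrable (count_space UNIV) h"
    using h h0 abs_summable_equivalent[of h UNIV] by (simp add: Infinite_Set_Sum.abs_summable_on_def)
  have int: "integrable (count_space UNIV) (f n)" for n
    by (rule Bochner_Integration.integrable_bound[OF ih]) (use le h0 in auto)
  have "(\<lambda>n. integral\<^sup>L (count_space UNIV) (f n)) \<longlonglongrightarrow> integral\<^sup>L (count_space UNIV) (\<lambda>_::'i. 0)"
    using ih le lim by (intro integral_dominated_convergence[where w = h]) auto
  moreover have "integral\<^sup>L (count_space UNIV) (f n) = (\<Sum>\<^sub>\<infinity>i. f n i)" for n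
    using infsetsum_infsum[of "f n" UNIV] int[of n]
    by (simp add: infsetsum_def Infinite_Set_Sum.abs_summable_on_def)
  ultimately show ?thesis
    by simp
qed

section \<open>Eigenfunction expansions of compactly embedded forms\<close>

text \<open>For small \<open>t\<close> of sign opposite to \<open>a\<close> the linear term would
  dominate. This extracts the Euler equation from a one-parameter variation.\<close>

lemma linear_coeff_eq_0:
  fixes a c :: real
  assumes "\<And>t. 0 \<le> 2 * t * a + t\<^sup>2 * c"
  shows "a = 0"
proof (rule ccontr)
  assume a: "a \<noteq> 0"
  define d where "d = \<bar>c\<bar> + 1"
  have d: "d > 0" "c < d" by (auto simp: d_def)
  \<comment> \<open>The value \<open>t = - a / d\<close> minimises
    \<open>2 * t * a + t\<^sup>2 * d\<close>; the choice of \<open>d\<close> makes it positive and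
    larger than \<open>c\<close>, whatever the sign of \<open>c\<close>.\<close>
  have "0 \<le> 2 * (- a / d) * a + (- a / d)\<^sup>2 * c" by (rule assms)
  also have "\<dots> \<le> 2 * (- a / d) * a + (- a / d)\<^sup>2 * d"
    using d by (intro add_left_mono mult_left_mono) auto
  also have "\<dots> = - (a\<^sup>2 / d)"
    using d by (simp add: field_simps power2_eq_square)
  finally show False
    using a d by (simp add: field_simps)
qed

text \<open>The rate \<open>1 / Suc n\<close> is explicit because later estimates use it: it bounds
  the components of near-minimal remainders and the energy along tails of a minimising
  sequence.\<close>

lemma Inf_approx:
  fixes F :: "'b \<Rightarrow> real"
  assumes "S \<noteq> {}" and "\<And>s. s \<in> S \<Longrightarrow> 0 \<le> F s"
  obtains s where "\<And>n::nat. s n \<in> S" "\<And>n. F (s n) < (INF s\<in>S. F s) + 1 / Suc n"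
    "\<And>s. s \<in> S \<Longrightarrow> (INF s\<in>S. F s) \<le> F s"
proof -
  have bdd: "bdd_below (F ` S)"
    using assms(2) by (intro bdd_belowI2[where m = 0]) auto
  have "\<exists>s\<in>S. F s < (INF s\<in>S. F s) + 1 / Suc n" for n :: nat
    using cINF_less_iff[OF assms(1) bdd, of "(INF s\<in>S. F s) + 1 / Suc n"] by auto
  then obtain s where "\<And>n. s n \<in> S \<and> F (s n) < (INF s\<in>S. F s) + 1 / Suc n"
    by metis
  with that cINF_lower[OF bdd] show ?thesis
    by blast
qed

lemma lin_span_zero: "(\<lambda>x. 0) \<in> lin_span B"
  unfolding lin_span_def by (auto intro!: exI[of _ "{}"])

lemma lin_span_add_scaled:
  assumes "s \<in> lin_span B" "v \<in> B"
  shows "(\<lambda>x. s x + c * v x) \<in> lin_span B"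
proof -
  obtain F a where F: "finite F" "F \<subseteq> B" and s: "s = (\<lambda>x. \<Sum>g\<in>F. a g * g x)"
    using assms(1) by (auto simp: lin_span_def)
  \<comment> \<open>\<open>v\<close> may already occur in \<open>F\<close>; adding the two guarded
    coefficients covers both cases.\<close>
  define a' where "a' g = (if g \<in> F then a g else 0) + (if g = v then c else 0)" for g
  have "(\<Sum>g\<in>insert v F. a' g * g x) = s x + c * v x" for x
  proof -
    have "(\<Sum>g\<in>insert v F. a' g * g x) = (\<Sum>g\<in>insert v F. (if g \<in> F then a g * g x else 0))
        + (\<Sum>g\<in>insert v F. (if g = v then c * g x else 0))"
      unfolding sum.distrib[symmetric] a'_def by (intro sum.cong) (auto simp: algebra_simps)
    also have "(\<Sum>g\<in>insert v F. (if g \<in> F then a g * g x else 0)) = (\<Sum>g\<in>F. a g * g x)"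
      using F by (intro sum.mono_neutral_cong_right) auto
    finally show ?thesis
      using F by (simp add: s)
  qed
  then have "(\<lambda>x. s x + c * v x) = (\<lambda>x. \<Sum>g\<in>insert v F. a' g * g x)"
    by auto
  then show ?thesis
    using F assms(2) unfolding lin_span_def by blast
qed

text \<open>\<open>p\<close> is the ambient inner product and \<open>q\<close> the form.
  \<open>compact\<close> says that sequences bounded in both have a \<open>p\<close>-convergent
  subsequence with limit in \<open>D\<close>; one constant \<open>C\<close> serves for both
  bounds.\<close>

locale compact_form =
  fixes D :: "('a \<Rightarrow> real) set" and q p :: "('a \<Rightarrow> real) \<Rightarrow> ('a \<Rightarrow> real) \<Rightarrow> real"
  assumes zero_mem: "(\<lambda>x. 0) \<in> D"
    and comb: "f \<in> D \<Longrightarrow> g \<in> D \<Longrightarrow> (\<lambda>x. s * f x + t * g x) \<in> D"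
    and p_sym: "p f g = p g f"
    and q_sym: "q f g = q g f"
    and p_comb: "f \<in> D \<Longrightarrow> g \<in> D \<Longrightarrow> h \<in> D \<Longrightarrow> p (\<lambda>x. s * f x + t * g x) h = s * p f h + t * p g h"
    and q_comb: "f \<in> D \<Longrightarrow> g \<in> D \<Longrightarrow> h \<in> D \<Longrightarrow> q (\<lambda>x. s * f x + t * g x) h = s * q f h + t * q g h"
    and q_nonneg: "f \<in> D \<Longrightarrow> 0 \<le> q f f"
    and p_pos: "f \<in> D \<Longrightarrow> f \<noteq> (\<lambda>x. 0) \<Longrightarrow> 0 < p f f"
    and compact: "(\<And>n::nat. F n \<in> D) \<Longrightarrow> (\<And>n. q (F n) (F n) \<le> C) \<Longrightarrow>
      (\<And>n. p (F n) (F n) \<le> C) \<Longrightarrow> \<exists>r g. strict_mono r \<and> g \<in> D \<and>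
        (\<lambda>n. p (\<lambda>x. F (r n) x - g x) (\<lambda>x. F (r n) x - g x)) \<longlonglongrightarrow> 0"
    and lsc: "(\<And>n::nat. F n \<in> D) \<Longrightarrow> g \<in> D \<Longrightarrow> (\<And>n. q (F n) (F n) \<le> C) \<Longrightarrow>
      (\<lambda>n. p (\<lambda>x. F n x - g x) (\<lambda>x. F n x - g x)) \<longlonglongrightarrow> 0 \<Longrightarrow> q g g \<le> C"
begin

section \<open>Bilinear calculus and the Cauchy-Schwarz inequality\<close>

lemma add_scaled: "f \<in> D \<Longrightarrow> g \<in> D \<Longrightarrow> (\<lambda>x. f x + t * g x) \<in> D"
  using comb[of f g 1 t] by simp

lemma diff: "f \<in> D \<Longrightarrow> g \<in> D \<Longrightarrow> (\<lambda>x. f x - g x) \<in> D"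
  using comb[of f g 1 "- 1"] by simp

lemma scaled: "f \<in> D \<Longrightarrow> (\<lambda>x. s * f x) \<in> D"
  using comb[of f f s 0] by simp

lemma p_add_scaled:
  assumes "f \<in> D" "g \<in> D" "h \<in> D"
  shows "p (\<lambda>x. f x + t * g x) h = p f h + t * p g h" "p h (\<lambda>x. f x + t * g x) = p h f + t * p h g"
  using p_comb[OF assms, of 1 t] by (simp_all add: p_sym)

lemma q_add_scaled:
  assumes "f \<in> D" "g \<in> D" "h \<in> D"
  shows "q (\<lambda>x. f x + t * g x) h = q f h + t * q g h" "q h (\<lambda>x. f x + t * g x) = q h f + t * q h g"
  using q_comb[OF assms, of 1 t] by (simp_all add: q_sym)

lemma p_diff:
  assumes "f \<in> D" "g \<in> D" "h \<in> D"
  shows "p (\<lambda>x. f x - g x) h = p f h - p g h"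
  using p_comb[OF assms, of 1 "- 1"] by simp

lemma p_scaled:
  assumes "f \<in> D" "h \<in> D"
  shows "p (\<lambda>x. s * f x) h = s * p f h"
  using p_comb[OF assms(1,1,2), of s 0] by simp

lemma q_scaled:
  assumes "f \<in> D" "h \<in> D"
  shows "q (\<lambda>x. s * f x) h = s * q f h"
  using q_comb[OF assms(1,1,2), of s 0] by simp

lemma p_scaled_self: "f \<in> D \<Longrightarrow> p (\<lambda>x. s * f x) (\<lambda>x. s * f x) = s\<^sup>2 * p f f"
  using p_scaled[of f "\<lambda>x. s * f x" s] p_scaled[of f f s]
  by (simp add: scaled p_sym[of f "\<lambda>x. s * f x"] power2_eq_square)

lemma q_scaled_self: "f \<in> D \<Longrightarrow> q (\<lambda>x. s * f x) (\<lambda>x. s * f x) = s\<^sup>2 * q f f"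
  using q_scaled[of f "\<lambda>x. s * f x" s] q_scaled[of f f s]
  by (simp add: scaled q_sym[of f "\<lambda>x. s * f x"] power2_eq_square)

lemma p_add_scaled_self:
  assumes "f \<in> D" "g \<in> D"
  shows "p (\<lambda>x. f x + t * g x) (\<lambda>x. f x + t * g x) = p f f + 2 * t * p f g + t\<^sup>2 * p g g"
  using assms by (simp add: p_add_scaled add_scaled p_sym[of g f] power2_eq_square algebra_simps)

lemma q_add_scaled_self:
  assumes "f \<in> D" "g \<in> D"
  shows "q (\<lambda>x. f x + t * g x) (\<lambda>x. f x + t * g x) = q f f + 2 * t * q f g + t\<^sup>2 * q g g"
  using assms by (simp add: q_add_scaled add_scaled q_sym[of g f] power2_eq_square algebra_simps)

lemma p_nonneg:
  assumes "f \<in> D"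
  shows "0 \<le> p f f"
proof (cases "f = (\<lambda>x. 0)")
  case True
  then show ?thesis
    using p_comb[OF assms assms assms, of 0 0] by simp
next
  case False
  then show ?thesis
    using p_pos[OF assms] by simp
qed

lemma cauchy_schwarz:
  assumes f: "f \<in> D" and g: "g \<in> D"
  shows "(p f g)\<^sup>2 \<le> p f f * p g g"
proof (cases "g = (\<lambda>x. 0)")
  case True
  then have "p g f = 0"
    using p_comb[OF f f f, of 0 0] by simp
  then show ?thesis
    using p_nonneg f g by (simp add: p_sym[of f g])
next
  case False
  then have g0: "0 < p g g"
    using p_pos[OF g] by simp
  have "0 \<le> p f f + 2 * (- (p f g / p g g)) * p f g + (- (p f g / p g g))\<^sup>2 * p g g"
    using p_nonneg[OF add_scaled[OF f g]] p_add_scaled_self[OF f g] by metis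
  also have "\<dots> = p f f - (p f g)\<^sup>2 / p g g"
    using g0 by (simp add: field_simps power2_eq_square)
  finally show ?thesis
    using g0 by (simp add: field_simps)
qed

section \<open>Continuity of the inner product along convergent sequences\<close>

context
  fixes f :: "nat \<Rightarrow> 'a \<Rightarrow> real" and g
  assumes f: "\<And>n. f n \<in> D" and g: "g \<in> D"
    and lim: "(\<lambda>n. p (\<lambda>x. f n x - g x) (\<lambda>x. f n x - g x)) \<longlonglongrightarrow> 0"
begin

lemma p_tendsto:
  assumes h: "h \<in> D"
  shows "(\<lambda>n. p (f n) h) \<longlonglongrightarrow> p g h"
proof -
  have "(\<lambda>n. p (\<lambda>x. f n x - g x) (\<lambda>x. f n x - g x) * p h h) \<longlonglongrightarrow> 0"
    using tendsto_mult_right[OF lim, of "p h h"] by simp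
  then have "(\<lambda>n. (p (f n) h - p g h)\<^sup>2) \<longlonglongrightarrow> 0"
  proof (rule Lim_null_comparison[rotated], intro always_eventually allI)
    fix n
    show "norm ((p (f n) h - p g h)\<^sup>2) \<le> p (\<lambda>x. f n x - g x) (\<lambda>x. f n x - g x) * p h h"
      using cauchy_schwarz[OF diff[OF f g] h, of n] p_diff[OF f g h, of n] by simp
  qed
  then have "(\<lambda>n. p (f n) h - p g h) \<longlonglongrightarrow> 0"
    by simp
  then show ?thesis
    by (simp add: LIM_zero_iff)
qed

lemma p_self_tendsto: "(\<lambda>n. p (f n) (f n)) \<longlonglongrightarrow> p g g"
proof -
  have eq: "p (f n) (f n) = p (\<lambda>x. f n x - g x) (\<lambda>x. f n x - g x) + 2 * p (f n) g - p g g" for n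
    using p_add_scaled_self[OF f g, of n "- 1"] by simp
  have "(\<lambda>n. p (\<lambda>x. f n x - g x) (\<lambda>x. f n x - g x) + 2 * p (f n) g - p g g)
      \<longlonglongrightarrow> 0 + 2 * p g g - p g g"
    by (intro tendsto_intros lim p_tendsto g)
  then show ?thesis
    by (simp add: eq)
qed

end

definition eig :: "('a \<Rightarrow> real) \<Rightarrow> bool" where
  "eig v \<longleftrightarrow> v \<in> D \<and> (\<exists>l. \<forall>h\<in>D. q v h = l * p v h)"

definition orthonormal_eig :: "('a \<Rightarrow> real) set \<Rightarrow> bool" where
  "orthonormal_eig B \<longleftrightarrow>
     (\<forall>v\<in>B. eig v) \<and> (\<forall>v\<in>B. \<forall>u\<in>B. p v u = (if v = u then 1 else 0))"

definition perp :: "('a \<Rightarrow> real) set \<Rightarrow> ('a \<Rightarrow> real) set" where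
  "perp B = {f \<in> D. \<forall>v\<in>B. p f v = 0}"

text \<open>For an infinite \<open>B\<close> the projection of \<open>h\<close> onto \<open>perp B\<close> is only reached as a limit; this set
  collects the approximants, which subtract finitely many components of \<open>h\<close> along \<open>B\<close>
  and are invisible to \<open>perp B\<close>.\<close>

definition remainders :: "('a \<Rightarrow> real) set \<Rightarrow> ('a \<Rightarrow> real) \<Rightarrow> ('a \<Rightarrow> real) set" where
  "remainders B h = {k \<in> D. (\<lambda>x. h x - k x) \<in> lin_span B \<and> q k k \<le> q h h \<and> p k k \<le> p h h \<and>
     (\<forall>f\<in>perp B. q f k = q f h \<and> p f k = p f h)}"

lemma self_in_remainders: "h \<in> D \<Longrightarrow> h \<in> remainders B h"
  by (simp add: remainders_def lin_span_zero)

text \<open>Removing the component along \<open>v\<close> lowers \<open>p\<close> by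
  \<open>(p k v)\<^sup>2\<close> and \<open>q\<close> by \<open>l * (p k v)\<^sup>2\<close>, where
  \<open>l = q v v\<close> is nonnegative, so both bounds survive. Vectors of \<open>perp B\<close>
  are also \<open>q\<close>-orthogonal to \<open>v\<close> by the eigenvalue equation, so their
  pairings do not change.\<close>

lemma remainders_step:
  assumes B: "orthonormal_eig B" and v: "v \<in> B" and k: "k \<in> remainders B h"
  defines "k' \<equiv> \<lambda>x. k x - p k v * v x"
  shows "k' \<in> remainders B h" and "p k' k' = p k k - (p k v)\<^sup>2"
proof -
  have vv: "p v v = 1"
    using B v by (simp add: orthonormal_eig_def)
  obtain l where vD: "v \<in> D" and l: "\<And>g. g \<in> D \<Longrightarrow> q v g = l * p v g"
    using B v unfolding orthonormal_eig_def eig_def by blast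
  have kD: "k \<in> D" and sp: "(\<lambda>x. h x - k x) \<in> lin_span B"
    and qk: "q k k \<le> q h h" and pk: "p k k \<le> p h h"
    and pr: "\<And>f. f \<in> perp B \<Longrightarrow> q f k = q f h \<and> p f k = p f h"
    using k by (auto simp: remainders_def)
  have k': "k' = (\<lambda>x. k x + (- p k v) * v x)"
    by (simp add: k'_def)
  have k'D: "k' \<in> D"
    unfolding k' by (rule add_scaled[OF kD vD])
  have l0: "l \<ge> 0"
    using q_nonneg[OF vD] l[OF vD] vv by simp
  show pk': "p k' k' = p k k - (p k v)\<^sup>2"
    unfolding k' p_add_scaled_self[OF kD vD] by (simp add: vv power2_eq_square)
  have "q k' k' = q k k - l * (p k v)\<^sup>2"
    unfolding k' q_add_scaled_self[OF kD vD]
    using l[OF kD] l[OF vD] by (simp add: vv p_sym[of v k] q_sym[of v k] power2_eq_square)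
  then have "q k' k' \<le> q h h"
    using qk l0 by (smt (verit) mult_nonneg_nonneg zero_le_power2)
  moreover have "p k' k' \<le> p h h"
    using pk pk' by (smt (verit) zero_le_power2)
  moreover have "(\<lambda>x. h x - k' x) \<in> lin_span B"
    using lin_span_add_scaled[OF sp v, of "p k v"] by (simp add: k'_def algebra_simps)
  moreover have "q f k' = q f h \<and> p f k' = p f h" if f: "f \<in> perp B" for f
  proof -
    have fD: "f \<in> D" and fv: "p f v = 0"
      using f v by (auto simp: perp_def)
    have "q f v = 0"
      using l[OF fD] fv by (simp add: q_sym[of f v] p_sym[of f v])
    then show ?thesis
      using pr[OF f] unfolding k' q_add_scaled(2)[OF kD vD fD] p_add_scaled(2)[OF kD vD fD]
      by (simp add: fv)
  qed
  ultimately show "k' \<in> remainders B h"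
    using k'D by (auto simp: remainders_def)
qed

text \<open>Substitute for the orthogonal projection: minimise \<open>p\<close> over the remainders.
  A limit with a nonzero component along some \<open>v\<close> in \<open>B\<close> would let one
  more subtraction fall below the infimum.\<close>

lemma remainders_limit:
  assumes B: "orthonormal_eig B" and h: "h \<in> D"
  obtains k g where "\<And>n::nat. k n \<in> remainders B h" "g \<in> perp B"
    "(\<lambda>n. p (\<lambda>x. k n x - g x) (\<lambda>x. k n x - g x)) \<longlonglongrightarrow> 0"
proof -
  let ?R = "remainders B h"
  define d where "d = (INF s\<in>?R. p s s)"
  have RD: "k \<in> D" if "k \<in> ?R" for k
    using that by (simp add: remainders_def)
  obtain k where k: "\<And>n::nat. k n \<in> ?R" and kd: "\<And>n. p (k n) (k n) < d + 1 / Suc n"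
    and dle: "\<And>s. s \<in> ?R \<Longrightarrow> d \<le> p s s"
    using Inf_approx[of ?R "\<lambda>s. p s s"] self_in_remainders[OF h] p_nonneg RD
    unfolding d_def by blast
  have "\<exists>r g. strict_mono r \<and> g \<in> D \<and>
      (\<lambda>n. p (\<lambda>x. k (r n) x - g x) (\<lambda>x. k (r n) x - g x)) \<longlonglongrightarrow> 0"
  proof (rule compact)
    show "q (k n) (k n) \<le> max (q h h) (p h h)" "p (k n) (k n) \<le> max (q h h) (p h h)" for n
      using k[of n] by (auto simp: remainders_def)
  qed (use k RD in auto)
  then obtain r g where r: "strict_mono r" and g: "g \<in> D"
    and lim: "(\<lambda>n. p (\<lambda>x. k (r n) x - g x) (\<lambda>x. k (r n) x - g x)) \<longlonglongrightarrow> 0"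
    by blast
  have "p g v = 0" if v: "v \<in> B" for v
  proof -
    have vD: "v \<in> D"
      using B v by (auto simp: orthonormal_eig_def eig_def)
    \<comment> \<open>Subtracting the component along \<open>v\<close> gives another remainder,
      whose \<open>p\<close> value is still at least \<open>d\<close>, while \<open>k n\<close>
      exceeds \<open>d\<close> by less than \<open>1 / Suc n\<close>.\<close>
    have sq: "(p (k n) v)\<^sup>2 \<le> 1 / Suc n" for n
      using dle[OF remainders_step(1)[OF B v k]] remainders_step(2)[OF B v k] kd[of n]
      by (smt (verit))
    have "(\<lambda>n. (p (k n) v)\<^sup>2) \<longlonglongrightarrow> 0"
    proof (rule Lim_null_comparison)
      show "(\<lambda>n. 1 / real (Suc n)) \<longlonglongrightarrow> 0"
        using LIMSEQ_inverse_real_of_nat by (simp add: inverse_eq_divide)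
    qed (use sq in auto)
    then have "(\<lambda>n. (p (k (r n)) v)\<^sup>2) \<longlonglongrightarrow> 0"
      using LIMSEQ_subseq_LIMSEQ[OF _ r] by (force simp: o_def)
    moreover have "(\<lambda>n. (p (k (r n)) v)\<^sup>2) \<longlonglongrightarrow> (p g v)\<^sup>2"
      by (intro tendsto_power p_tendsto[OF _ g lim vD] RD k)
    ultimately show ?thesis
      using LIMSEQ_unique by fastforce
  qed
  then have "g \<in> perp B"
    using g by (simp add: perp_def)
  then show ?thesis
    using that[of "\<lambda>n. k (r n)" g] k lim by blast
qed

text \<open>A minimising sequence of unit vectors is bounded in both forms, hence has a
  \<open>p\<close>-limit. Orthogonality and unit norm survive by continuity of \<open>p\<close>,
  minimality by \<open>lsc\<close>. The homogeneous form of the conclusion spares later uses from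
  normalising.\<close>

lemma perp_minimizer:
  assumes B: "B \<subseteq> D" and g0: "g0 \<in> perp B" "g0 \<noteq> (\<lambda>x. 0)"
  obtains f where "f \<in> perp B" "p f f = 1" "\<And>g. g \<in> perp B \<Longrightarrow> q f f * p g g \<le> q g g"
proof -
  let ?S = "{f \<in> perp B. p f f = 1}"
  define d where "d = (INF f\<in>?S. q f f)"
  have PD: "f \<in> D" if "f \<in> perp B" for f
    using that by (simp add: perp_def)
  have unit: "(\<lambda>x. 1 / sqrt (p g g) * g x) \<in> ?S" if g: "g \<in> perp B" "g \<noteq> (\<lambda>x. 0)" for g
  proof -
    have "0 < p g g"
      using p_pos g PD by blast
    then have "p (\<lambda>x. 1 / sqrt (p g g) * g x) (\<lambda>x. 1 / sqrt (p g g) * g x) = 1"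
      unfolding p_scaled_self[OF PD[OF g(1)]] by (simp add: power_divide)
    moreover have "(\<lambda>x. 1 / sqrt (p g g) * g x) \<in> perp B"
      unfolding perp_def mem_Collect_eq
    proof (intro conjI ballI)
      fix v assume "v \<in> B"
      then show "p (\<lambda>x. 1 / sqrt (p g g) * g x) v = 0"
        using p_scaled[OF PD[OF g(1)], of v "1 / sqrt (p g g)"] B g(1) by (auto simp: perp_def)
    qed (rule scaled[OF PD[OF g(1)]])
    ultimately show ?thesis
      by simp
  qed
  have "?S \<noteq> {}"
    using unit[OF g0] by blast
  moreover have "0 \<le> q s s" if "s \<in> ?S" for s
    using that q_nonneg PD by simp
  ultimately obtain f where fS: "\<And>n::nat. f n \<in> ?S" and fd: "\<And>n. q (f n) (f n) < d + 1 / Suc n"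
    and dle: "\<And>s. s \<in> ?S \<Longrightarrow> d \<le> q s s"
    using Inf_approx[of ?S "\<lambda>s. q s s"] unfolding d_def by blast
  have fD: "f n \<in> D" for n
    using fS PD by simp
  have fd1: "q (f n) (f n) \<le> d + 1" for n
    using fd[of n] by (smt (verit) divide_le_eq_1 of_nat_0_le_iff of_nat_Suc)
  have "\<exists>r g. strict_mono r \<and> g \<in> D \<and>
      (\<lambda>n. p (\<lambda>x. f (r n) x - g x) (\<lambda>x. f (r n) x - g x)) \<longlonglongrightarrow> 0"
  proof (rule compact[OF fD])
    show "q (f n) (f n) \<le> max (d + 1) 1" "p (f n) (f n) \<le> max (d + 1) 1" for n
      using fd1[of n] fS[of n] by auto
  qed
  then obtain r g where r: "strict_mono r" and g: "g \<in> D"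
    and lim: "(\<lambda>n. p (\<lambda>x. f (r n) x - g x) (\<lambda>x. f (r n) x - g x)) \<longlonglongrightarrow> 0"
    by blast
  have "p g v = 0" if v: "v \<in> B" for v
  proof -
    have "(\<lambda>n. p (f (r n)) v) \<longlonglongrightarrow> p g v"
      using p_tendsto[OF fD g lim] v B by blast
    moreover have "p (f (r n)) v = 0" for n
      using fS v by (auto simp: perp_def)
    ultimately show ?thesis
      using LIMSEQ_unique[OF tendsto_const] by fastforce
  qed
  then have gP: "g \<in> perp B"
    using g by (simp add: perp_def)
  have "(\<lambda>n. p (f (r n)) (f (r n))) \<longlonglongrightarrow> p g g"
    using p_self_tendsto[OF fD g lim] .
  moreover have "p (f (r n)) (f (r n)) = 1" for n
    using fS by auto
  ultimately have g1: "p g g = 1"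
    using LIMSEQ_unique[OF tendsto_const] by fastforce
  \<comment> \<open>\<open>lsc\<close> wants a bound valid for every term, so the first
    \<open>N\<close> terms are dropped; \<open>r (n + N)\<close> is at least \<open>N\<close>, which
    gives the bound on the rest.\<close>
  have "q g g \<le> d + 1 / Suc N" for N
  proof (rule lsc)
    show "f (r (n + N)) \<in> D" for n
      by (rule fD)
    show "(\<lambda>n. p (\<lambda>x. f (r (n + N)) x - g x) (\<lambda>x. f (r (n + N)) x - g x)) \<longlonglongrightarrow> 0"
      using LIMSEQ_ignore_initial_segment[OF lim] .
    show "q (f (r (n + N))) (f (r (n + N))) \<le> d + 1 / Suc N" for n
    proof -
      have "N \<le> r (n + N)"
        using seq_suble[OF r, of "n + N"] by simp
      then have "1 / real (Suc (r (n + N))) \<le> 1 / real (Suc N)"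
        by (intro divide_left_mono) auto
      then show ?thesis
        using fd[of "r (n + N)"] by linarith
    qed
  qed (rule g)
  moreover have "(\<lambda>N. d + 1 / real (Suc N)) \<longlonglongrightarrow> d + 0"
    using LIMSEQ_inverse_real_of_nat by (intro tendsto_intros) (simp add: inverse_eq_divide)
  ultimately have qd: "q g g \<le> d"
    using LIMSEQ_le_const[of "\<lambda>N. d + 1 / real (Suc N)" "d + 0" "q g g"] by auto
  have "q g g * p u u \<le> q u u" if u: "u \<in> perp B" for u
  proof (cases "u = (\<lambda>x. 0)")
    case True
    then have "p u u = 0"
      using p_comb[OF g g PD[OF u], of 0 0] by simp
    then show ?thesis
      using q_nonneg PD u by simp
  next
    case False
    have pu: "0 < p u u"
      using p_pos False PD u by blast
    have "d \<le> (1 / sqrt (p u u))\<^sup>2 * q u u"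
      using dle[OF unit[OF u False]] unfolding q_scaled_self[OF PD[OF u]] .
    then have "d * p u u \<le> q u u"
      using pu by (simp add: power_divide pos_le_divide_eq)
    with mult_right_mono[OF qd less_imp_le[OF pu]] show ?thesis
      by linarith
  qed
  then show ?thesis
    using that[OF gP g1] by blast
qed

text \<open>A test vector \<open>h\<close> in \<open>D\<close> is replaced by the limit
  \<open>g\<close> in \<open>perp B\<close> of its remainders, which is an admissible variation of
  \<open>f\<close>. The remainders pair with \<open>f\<close> exactly as \<open>h\<close> does, so
  the resulting inequality is expressed through \<open>h\<close>.\<close>

lemma minimizer_eig:
  assumes B: "orthonormal_eig B" and f: "f \<in> perp B" and f1: "p f f = 1"
    and min: "\<And>g. g \<in> perp B \<Longrightarrow> q f f * p g g \<le> q g g"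
  shows "eig f"
proof -
  have fD: "f \<in> D"
    using f by (simp add: perp_def)
  have BD: "v \<in> D" if "v \<in> B" for v
    using that B by (auto simp: orthonormal_eig_def eig_def)
  define l where "l = q f f"
  have l0: "0 \<le> l"
    unfolding l_def by (rule q_nonneg[OF fD])
  have "q f h = l * p f h" if h: "h \<in> D" for h
  proof -
    obtain k g where k: "\<And>n::nat. k n \<in> remainders B h" and g: "g \<in> perp B"
      and lim: "(\<lambda>n. p (\<lambda>x. k n x - g x) (\<lambda>x. k n x - g x)) \<longlonglongrightarrow> 0"
      using remainders_limit[OF B h] by blast
    have kD: "k n \<in> D" and qk: "q (k n) (k n) \<le> q h h" and qfk: "q f (k n) = q f h"
      and pfk: "p f (k n) = p f h" for n
      using k[of n] f by (auto simp: remainders_def)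
    have gD: "g \<in> D"
      using g by (simp add: perp_def)
    have pfg: "p f g = p f h"
      using p_tendsto[OF kD gD lim fD] LIMSEQ_unique[OF tendsto_const]
      by (fastforce simp: p_sym[of _ f] pfk)
    \<comment> \<open>The coefficient of \<open>t\<^sup>2\<close> only has to be independent of
      \<open>t\<close>, so the crude value \<open>q h h\<close> suffices.\<close>
    have "0 \<le> 2 * t * (q f h - l * p f h) + t\<^sup>2 * q h h" for t
    proof -
      let ?u = "\<lambda>x. f x + t * g x"
      have uD: "?u \<in> D"
        by (rule add_scaled[OF fD gD])
      have "?u \<in> perp B"
        using f g BD uD by (auto simp: perp_def p_add_scaled)
      then have "l * p ?u ?u \<le> q ?u ?u"
        using min unfolding l_def by blast
      also have "q ?u ?u \<le> l + 2 * t * q f h + t\<^sup>2 * q h h"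
      proof (rule lsc[where F = "\<lambda>n x. f x + t * k n x"])
        show "(\<lambda>x. f x + t * k n x) \<in> D" for n
          by (rule add_scaled[OF fD kD])
        show "q (\<lambda>x. f x + t * k n x) (\<lambda>x. f x + t * k n x) \<le> l + 2 * t * q f h + t\<^sup>2 * q h h" for n
          unfolding q_add_scaled_self[OF fD kD] qfk l_def
          by (simp add: mult_left_mono qk)
        have "(\<lambda>x. f x + t * k n x - (f x + t * g x)) = (\<lambda>x. t * (k n x - g x))" for n
          by (simp add: algebra_simps)
        then show "(\<lambda>n. p (\<lambda>x. f x + t * k n x - (f x + t * g x))
            (\<lambda>x. f x + t * k n x - (f x + t * g x))) \<longlonglongrightarrow> 0"
          using tendsto_mult_left[OF lim, of "t\<^sup>2"] p_scaled_self[OF diff[OF kD gD]] by simp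
      qed (rule uD)
      finally have "l * (1 + 2 * t * p f h + t\<^sup>2 * p g g) \<le> l + 2 * t * q f h + t\<^sup>2 * q h h"
        unfolding p_add_scaled_self[OF fD gD] f1 pfg .
      moreover have "0 \<le> l * (t\<^sup>2 * p g g)"
        using l0 p_nonneg[OF gD] by simp
      ultimately show ?thesis
        by (simp add: algebra_simps)
    qed
    then have "q f h - l * p f h = 0"
      by (rule linear_coeff_eq_0)
    then show ?thesis
      by simp
  qed
  then show ?thesis
    using fD unfolding eig_def by blast
qed

text \<open>Zorn's lemma applies because orthonormality concerns pairs, and any two members of the
  union of a chain lie in a common set of the chain. A nonzero element of \<open>perp B\<close>
  would yield a unit minimiser, an eigenvector that properly enlarges \<open>B\<close>.\<close>

lemma maximal_orthonormal_eig:
  obtains B where "orthonormal_eig B" "perp B = {\<lambda>x. 0}"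
proof -
  have "\<exists>B\<in>{B. orthonormal_eig B}. \<forall>X\<in>{B. orthonormal_eig B}. B \<subseteq> X \<longrightarrow> X = B"
  proof (rule subset_Zorn')
    fix C assume C: "subset.chain {B. orthonormal_eig B} C"
    then have on: "\<And>X. X \<in> C \<Longrightarrow> orthonormal_eig X"
      by (auto simp: subset_chain_def)
    have "\<exists>X\<in>C. u \<in> X \<and> v \<in> X" if uv: "u \<in> \<Union>C" "v \<in> \<Union>C" for u v
    proof -
      obtain X Y where "X \<in> C" "u \<in> X" "Y \<in> C" "v \<in> Y"
        using uv by blast
      moreover have "X \<subseteq> Y \<or> Y \<subseteq> X"
        using C \<open>X \<in> C\<close> \<open>Y \<in> C\<close> by (auto simp: subset_chain_def)
      ultimately show ?thesis
        by blast
    qed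
    then show "\<Union>C \<in> {B. orthonormal_eig B}"
      using on unfolding orthonormal_eig_def mem_Collect_eq by (metis Union_iff)
  qed
  then obtain B where B: "orthonormal_eig B"
    and max: "\<And>X. orthonormal_eig X \<Longrightarrow> B \<subseteq> X \<Longrightarrow> X = B"
    by auto
  have BD: "B \<subseteq> D"
    using B by (auto simp: orthonormal_eig_def eig_def)
  have z: "(\<lambda>x. 0) \<in> perp B"
    using p_scaled[OF zero_mem, of _ 0] zero_mem BD by (auto simp: perp_def)
  have "g = (\<lambda>x. 0)" if g: "g \<in> perp B" for g
  proof (rule ccontr)
    assume "g \<noteq> (\<lambda>x. 0)"
    then obtain f where f: "f \<in> perp B" "p f f = 1" "\<And>g. g \<in> perp B \<Longrightarrow> q f f * p g g \<le> q g g"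
      using perp_minimizer[OF BD g] by blast
    have ff: "p f v = 0 \<and> p v f = 0" if "v \<in> B" for v
      using f(1) that p_sym[of v f] by (simp add: perp_def)
    have "f \<notin> B"
      using ff f(2) by force
    moreover have "orthonormal_eig (insert f B)"
      using B minimizer_eig[OF B f] f(2) ff \<open>f \<notin> B\<close> unfolding orthonormal_eig_def by auto
    ultimately show False
      using max[of "insert f B"] by blast
  qed
  with z have "perp B = {\<lambda>x. 0}"
    by blast
  with B show ?thesis
    by (rule that)
qed

text \<open>Since \<open>perp B\<close> is trivial, the remainders of \<open>h\<close> found above
  tend to zero, and \<open>h\<close> minus a remainder lies in the span.\<close>

theorem eigenbasis:
  obtains B where "\<And>v. v \<in> B \<Longrightarrow> eig v"
    "\<And>v u. v \<in> B \<Longrightarrow> u \<in> B \<Longrightarrow> p v u = (if v = u then 1 else 0)"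
    "\<And>h e. h \<in> D \<Longrightarrow> 0 < e \<Longrightarrow> \<exists>s\<in>lin_span B. p (\<lambda>x. h x - s x) (\<lambda>x. h x - s x) < e"
proof -
  obtain B where B: "orthonormal_eig B" and perp0: "perp B = {\<lambda>x. 0}"
    by (rule maximal_orthonormal_eig)
  have dense: "\<exists>s\<in>lin_span B. p (\<lambda>x. h x - s x) (\<lambda>x. h x - s x) < e" if h: "h \<in> D" and e: "0 < e" for h e
  proof -
    obtain k g where k: "\<And>n::nat. k n \<in> remainders B h" and g: "g \<in> perp B"
      and lim: "(\<lambda>n. p (\<lambda>x. k n x - g x) (\<lambda>x. k n x - g x)) \<longlonglongrightarrow> 0"
      using remainders_limit[OF B h] by blast
    have "(\<lambda>n. p (k n) (k n)) \<longlonglongrightarrow> 0"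
      using lim g perp0 by simp
    then obtain n where n: "p (k n) (k n) < e"
      using order_tendstoD(2)[OF _ e] eventually_sequentially by (metis (no_types, lifting) order_refl)
    moreover have "(\<lambda>x. h x - k n x) \<in> lin_span B"
      using k by (simp add: remainders_def)
    ultimately show ?thesis
      by (intro bexI[of _ "\<lambda>x. h x - k n x"]) auto
  qed
  from B have "\<And>v. v \<in> B \<Longrightarrow> eig v"
    "\<And>v u. v \<in> B \<Longrightarrow> u \<in> B \<Longrightarrow> p v u = (if v = u then 1 else 0)"
    by (auto simp: orthonormal_eig_def)
  with dense show ?thesis
    using that by blast
qed

lemma lin_span_subset:
  assumes "B \<subseteq> D"
  shows "lin_span B \<subseteq> D"
proof -
  have "(\<lambda>x. \<Sum>g\<in>F. a g * g x) \<in> D" if "finite F" "F \<subseteq> D" for F a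
    using that
  proof (induction F)
    case empty
    then show ?case by (simp add: zero_mem)
  next
    case (insert g F)
    then have "(\<lambda>x. 1 * (\<Sum>g\<in>F. a g * g x) + a g * g x) \<in> D"
      by (intro comb) auto
    with insert show ?case
      by (simp add: add.commute)
  qed
  then show ?thesis
    using assms by (fastforce simp: lin_span_def)
qed

end

section \<open>The Neumann form of a graph with a Poincare inequality\<close>

lemma variation_norm_ge: "ereal (f x - f y) \<le> variation_norm f"
proof -
  have "ereal (f x) - ereal (f y) \<le> variation_norm f"
    unfolding variation_norm_def by (intro ereal_minus_mono SUP_upper INF_lower) auto
  then show ?thesis by simp
qed

lemma ell2_eq_wl2: "ell2 m = wl2 (\<lambda>x. measure m {x})"
  by (simp add: ell2_def wl2_def)

lemma ell2_inner_eq_wl2: "ell2_inner m = wl2_inner (\<lambda>x. measure m {x})"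
  by (simp add: ell2_inner_def wl2_inner_def fun_eq_iff)

lemma ell2_norm_less_iff:
  assumes "0 < e"
  shows "ell2_norm m f < e \<longleftrightarrow> ell2_inner m f f < e\<^sup>2"
  using assms real_sqrt_less_iff[of "ell2_inner m f f" "e\<^sup>2"] by (simp add: ell2_norm_def)

context weighted_graph
begin

abbreviation "edge_weight \<equiv> (\<lambda>(x, y). b x y)"
abbreviation "grad f \<equiv> (\<lambda>(x, y). f x - f y :: real)"

lemma edge_weight_nonneg: "0 \<le> edge_weight e"
  using nonneg by (cases e) auto

lemma energy_space_iff: "f \<in> energy_space b \<longleftrightarrow> grad f \<in> wl2 edge_weight"
  by (simp add: energy_space_def wl2_def case_prod_unfold mult.commute)

lemma energy_eq: "energy b f g = 1 / 2 * wl2_inner edge_weight (grad f) (grad g)"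
  by (simp add: energy_def wl2_inner_def case_prod_unfold mult.commute mult.left_commute)

lemma grad_lincomb: "grad (\<lambda>x. s * f x + t * g x) = (\<lambda>e. s * grad f e + t * grad g e)"
  by (auto simp: algebra_simps)

lemma energy_space_lincomb:
  "f \<in> energy_space b \<Longrightarrow> g \<in> energy_space b \<Longrightarrow> (\<lambda>x. s * f x + t * g x) \<in> energy_space b"
  unfolding energy_space_iff grad_lincomb by (rule wl2_lincomb[OF edge_weight_nonneg])

lemma energy_lincomb:
  assumes "f \<in> energy_space b" "g \<in> energy_space b" "h \<in> energy_space b"
  shows "energy b (\<lambda>x. s * f x + t * g x) h = s * energy b f h + t * energy b g h"
  using wl2_inner_lincomb[OF edge_weight_nonneg assms[unfolded energy_space_iff]]
  unfolding energy_eq grad_lincomb by (simp add: algebra_simps)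

text \<open>Pointwise convergence passes to gradients, so this is Fatou on the edges.\<close>

lemma energy_fatou:
  assumes "\<And>n. f n \<in> energy_space b" "\<And>n. energy b (f n) (f n) \<le> C" "\<And>x. (\<lambda>n. f n x) \<longlonglongrightarrow> g x"
  shows "g \<in> energy_space b" "energy b g g \<le> C"
proof -
  have f: "grad (f n) \<in> wl2 edge_weight"
    and C: "wl2_inner edge_weight (grad (f n)) (grad (f n)) \<le> 2 * C" for n
    using assms(1)[of n] assms(2)[of n] by (auto simp: energy_space_iff energy_eq)
  have lim: "(\<lambda>n. grad (f n) e) \<longlonglongrightarrow> grad g e" for e
    by (auto simp: case_prod_beta intro!: tendsto_intros assms(3))
  show "g \<in> energy_space b" "energy b g g \<le> C"
    using wl2_fatou[OF edge_weight_nonneg f C lim] by (auto simp: energy_space_iff energy_eq)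
qed

text \<open>The variation norm is an extended real and squaring is monotone only on nonnegative
  values; hence the case \<open>f y \<le> f x\<close> comes first and symmetry gives the
  other.\<close>

lemma poincare_pointwise:
  assumes "global_poincare b"
  obtains c where "0 < c" "\<And>f x y. f \<in> energy_space b \<Longrightarrow> (f x - f y)\<^sup>2 \<le> c * energy b f f"
proof -
  obtain c where c: "0 < c" "\<And>f. f \<in> energy_space b \<Longrightarrow> (variation_norm f)\<^sup>2 \<le> ereal (c * energy b f f)"
    using assms unfolding global_poincare_def by blast
  have pos: "(f x - f y)\<^sup>2 \<le> c * energy b f f" if f: "f \<in> energy_space b" and "f y \<le> f x" for f x y
  proof -
    have "ereal ((f x - f y)\<^sup>2) = (ereal (f x - f y))\<^sup>2"
      by simp
    also have "\<dots> \<le> (variation_norm f)\<^sup>2"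
      unfolding power2_eq_square using that variation_norm_ge[of f y y]
      by (intro ereal_mult_mono variation_norm_ge) (auto simp: zero_ereal_def)
    also have "\<dots> \<le> ereal (c * energy b f f)"
      by (rule c(2)[OF f])
    finally show ?thesis by simp
  qed
  have "(f x - f y)\<^sup>2 \<le> c * energy b f f" if f: "f \<in> energy_space b" for f x y
    using pos[OF f, of x y] pos[OF f, of y x] by (cases "f y \<le> f x") (auto simp: power2_commute)
  with c(1) show ?thesis
    by (rule that)
qed

end

section \<open>Compact embedding of the Neumann form domain\<close>

lemma point_masses_summable:
  fixes m :: "'a::countable measure"
  assumes "sets m = UNIV" "finite_measure m"
  shows "(\<lambda>x. measure m {x}) summable_on UNIV"
proof -
  interpret finite_measure m by fact
  have "(\<Sum>x\<in>F. measure m {x}) \<le> measure m (space m)" if "finite F" for F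
    using finite_measure_finite_Union[of F "\<lambda>x. {x}"] that bounded_measure[of F] assms(1)
    by (simp add: disjoint_family_on_def)
  then show ?thesis
    by (intro nonneg_bdd_above_summable_on bdd_aboveI2[where M = "measure m (space m)"]) auto
qed

text \<open>The Poincare inequality and finiteness of \<open>m\<close> enter through
  \<open>compact\<close>. Full support gives definiteness of the inner product and makes l2
  convergence imply pointwise convergence.\<close>

lemma compact_form_neumann:
  fixes b :: "'a::countable \<Rightarrow> 'a \<Rightarrow> real" and m :: "'a measure"
  assumes b: "weighted_graph b" and poin: "global_poincare b" and sets: "sets m = UNIV"
    and fm: "finite_measure m" and full: "full_support m"
  shows "compact_form (neumann_form_dom b m) (energy b) (ell2_inner m)"
proof -
  interpret weighted_graph b by fact
  let ?D = "neumann_form_dom b m"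
  let ?w = "\<lambda>x. measure m {x}"
  have w0: "0 \<le> ?w x" and wpos: "0 < ?w x" for x
    using full by (auto simp: full_support_def)
  have ws: "?w summable_on UNIV"
    by (rule point_masses_summable[OF sets fm])
  have D: "f \<in> ?D \<longleftrightarrow> f \<in> energy_space b \<and> f \<in> wl2 ?w" for f
    by (simp add: neumann_form_dom_def ell2_eq_wl2)
  have bounded_wl2: "g \<in> wl2 ?w" if "\<And>x. \<bar>g x\<bar> \<le> M" for g M
  proof -
    have "(\<lambda>x. M\<^sup>2 * ?w x) summable_on UNIV"
      by (intro summable_on_cmult_right ws)
    moreover have "(g x)\<^sup>2 * ?w x \<le> M\<^sup>2 * ?w x" for x
      using that[of x] by (intro mult_right_mono w0 abs_le_square_iff[THEN iffD1]) auto
    ultimately show ?thesis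
      unfolding wl2_def by (auto intro: summable_on_comparison_test simp: w0)
  qed
  show ?thesis
  proof
    show "(\<lambda>x. 0) \<in> ?D"
      by (simp add: D energy_space_def wl2_def case_prod_unfold)
    show "(\<lambda>x. s * f x + t * g x) \<in> ?D" if "f \<in> ?D" "g \<in> ?D" for f g s t
      using that energy_space_lincomb wl2_lincomb[of ?w, OF w0] by (simp add: D)
    show "ell2_inner m f g = ell2_inner m g f" for f g
      unfolding ell2_inner_eq_wl2 by (rule wl2_inner_sym)
    show "energy b f g = energy b g f" for f g
      unfolding energy_eq by (subst wl2_inner_sym) simp
    show "ell2_inner m (\<lambda>x. s * f x + t * g x) h = s * ell2_inner m f h + t * ell2_inner m g h"
      if "f \<in> ?D" "g \<in> ?D" "h \<in> ?D" for f g h s t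
      unfolding ell2_inner_eq_wl2 using that by (intro wl2_inner_lincomb w0) (auto simp: D)
    show "energy b (\<lambda>x. s * f x + t * g x) h = s * energy b f h + t * energy b g h"
      if "f \<in> ?D" "g \<in> ?D" "h \<in> ?D" for f g h s t
      using that by (intro energy_lincomb) (auto simp: D)
    show "0 \<le> energy b f f" for f
      unfolding energy_eq using wl2_inner_self_nonneg[OF edge_weight_nonneg] by simp
    show "0 < ell2_inner m f f" if f: "f \<in> ?D" "f \<noteq> (\<lambda>x. 0)" for f
    proof -
      obtain x where "f x \<noteq> 0"
        using f(2) by auto
      then have "0 < (f x)\<^sup>2 * ?w x"
        using wpos by simp
      also have "\<dots> \<le> ell2_inner m f f"
        unfolding ell2_inner_eq_wl2 using f by (intro wl2_inner_ge_term w0) (simp add: D)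
      finally show ?thesis .
    qed
    show "energy b g g \<le> C" if f: "\<And>n. f n \<in> ?D" and g: "g \<in> ?D" and C: "\<And>n. energy b (f n) (f n) \<le> C"
      and lim: "(\<lambda>n. ell2_inner m (\<lambda>x. f n x - g x) (\<lambda>x. f n x - g x)) \<longlonglongrightarrow> 0"
    for f :: "nat \<Rightarrow> 'a \<Rightarrow> real" and g C
    proof (rule energy_fatou(2))
      show "f n \<in> energy_space b" for n
        using f by (simp add: D)
      show "(\<lambda>n. f n x) \<longlonglongrightarrow> g x" for x
      proof -
        \<comment> \<open>Each squared difference at \<open>x\<close>, times the mass of
          \<open>x\<close>, is one term of the squared norm; dividing by that positive mass gives
          the pointwise convergence needed for Fatou.\<close>
        have "(\<lambda>n. ell2_inner m (\<lambda>x. f n x - g x) (\<lambda>x. f n x - g x) / ?w x) \<longlonglongrightarrow> 0"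
          using tendsto_divide[OF lim tendsto_const[of "?w x"]] wpos[of x] by simp
        moreover have "(f n x - g x)\<^sup>2 \<le> ell2_inner m (\<lambda>x. f n x - g x) (\<lambda>x. f n x - g x) / ?w x" for n
          using wl2_inner_ge_term[of ?w, OF w0, of "\<lambda>x. f n x - g x" x] ell2_diff[of "f n" m g] f g wpos[of x]
          by (simp add: D ell2_eq_wl2 ell2_inner_eq_wl2 field_simps)
        ultimately have "(\<lambda>n. (f n x - g x)\<^sup>2) \<longlonglongrightarrow> 0"
          by (elim Lim_null_comparison[rotated]) simp
        then have "(\<lambda>n. f n x - g x) \<longlonglongrightarrow> 0"
          by simp
        then show ?thesis
          by (simp add: LIM_zero_iff)
      qed
    qed (rule C)
    show "\<exists>r g. strict_mono r \<and> g \<in> ?D \<and>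
        (\<lambda>n. ell2_inner m (\<lambda>x. f (r n) x - g x) (\<lambda>x. f (r n) x - g x)) \<longlonglongrightarrow> 0"
      if f: "\<And>n. f n \<in> ?D" and qC: "\<And>n. energy b (f n) (f n) \<le> C"
        and pC: "\<And>n. ell2_inner m (f n) (f n) \<le> C"
      for f :: "nat \<Rightarrow> 'a \<Rightarrow> real" and C
    proof -
      obtain c where c: "0 < c" "\<And>f x y. f \<in> energy_space b \<Longrightarrow> (f x - f y)\<^sup>2 \<le> c * energy b f f"
        using poincare_pointwise[OF poin] by blast
      define a :: 'a where "a = undefined"
      \<comment> \<open>The first summand bounds the oscillation \<open>f n x - f n a\<close> by the
        Poincare inequality, the second bounds \<open>f n a\<close> by the single term of the l2
        norm at \<open>a\<close>.\<close>
      define M where "M = sqrt (c * C) + sqrt (C / ?w a)"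
      have bound: "\<bar>f n x\<bar> \<le> M" for n x
      proof -
        have "(f n x - f n a)\<^sup>2 \<le> c * energy b (f n) (f n)"
          using c(2) f by (simp add: D)
        also have "\<dots> \<le> c * C"
          using c(1) qC by (simp add: mult_left_mono)
        finally have "\<bar>f n x - f n a\<bar> \<le> sqrt (c * C)"
          using real_sqrt_abs real_sqrt_le_iff by metis
        moreover have "(f n a)\<^sup>2 * ?w a \<le> C"
          using wl2_inner_ge_term[of ?w, OF w0, of "f n" a] f pC[of n]
          by (simp add: D ell2_inner_eq_wl2)
        then have "(f n a)\<^sup>2 \<le> C / ?w a"
          using wpos by (simp add: pos_le_divide_eq)
        then have "\<bar>f n a\<bar> \<le> sqrt (C / ?w a)"
          using real_sqrt_abs real_sqrt_le_iff by metis
        ultimately show ?thesis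
          unfolding M_def by linarith
      qed
      \<comment> \<open>Diagonal argument: uniformly bounded functions on a countable set have a
        pointwise convergent subsequence.\<close>
      obtain r where r: "strict_mono r" and "\<And>x. \<exists>l. (\<lambda>n. f (r n) x) \<longlonglongrightarrow> l"
        using function_convergent_subsequence[of UNIV f M] bound by auto
      then obtain g where g: "\<And>x. (\<lambda>n. f (r n) x) \<longlonglongrightarrow> g x"
        by metis
      have gM: "\<bar>g x\<bar> \<le> M" for x
        using LIMSEQ_le_const2[OF tendsto_rabs[OF g]] bound by blast
      have "g \<in> energy_space b"
        using energy_fatou(1)[of "\<lambda>n. f (r n)" C g] f qC g by (auto simp: D)
      then have "g \<in> ?D"
        using bounded_wl2[OF gM] by (simp add: D)
      moreover have "(\<lambda>n. ell2_inner m (\<lambda>x. f (r n) x - g x) (\<lambda>x. f (r n) x - g x)) \<longlonglongrightarrow> 0"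
        unfolding ell2_inner_def
      proof (rule infsum_tendsto_0_dominated)
        \<comment> \<open>Both \<open>f (r n)\<close> and \<open>g\<close> are bounded by
          \<open>M\<close>, and constants are summable against the finite measure.\<close>
        show "(\<lambda>x. (2 * M)\<^sup>2 * ?w x) summable_on UNIV"
          by (intro summable_on_cmult_right ws)
        show "\<bar>(f (r n) x - g x) * (f (r n) x - g x) * ?w x\<bar> \<le> (2 * M)\<^sup>2 * ?w x" for n x
        proof -
          have "\<bar>f (r n) x - g x\<bar> \<le> \<bar>2 * M\<bar>"
            using bound[of "r n" x] gM[of x] by linarith
          then have "(f (r n) x - g x)\<^sup>2 \<le> (2 * M)\<^sup>2"
            by (simp only: abs_le_square_iff)
          then show ?thesis
            by (simp add: abs_mult mult_right_mono power2_eq_square)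
        qed
        have "(\<lambda>n. (f (r n) x - g x) * (f (r n) x - g x) * ?w x) \<longlonglongrightarrow> (g x - g x) * (g x - g x) * ?w x" for x
          by (intro tendsto_intros g)
        then show "(\<lambda>n. (f (r n) x - g x) * (f (r n) x - g x) * ?w x) \<longlonglongrightarrow> 0" for x
          by simp
      qed
      ultimately show ?thesis
        using r by blast
    qed
  qed
qed

section \<open>Closures in the weighted l2 space\<close>

lemma subset_ell2_closure:
  assumes "S \<subseteq> ell2 m"
  shows "S \<subseteq> ell2_closure m S"
proof
  fix f assume f: "f \<in> S"
  have "ell2_norm m (\<lambda>x. f x - f x) = 0"
    by (simp add: ell2_norm_def ell2_inner_def)
  with f assms show "f \<in> ell2_closure m S"
    unfolding ell2_closure_def by force
qed

lemma ell2_closure_mono: "S \<subseteq> T \<Longrightarrow> ell2_closure m S \<subseteq> ell2_closure m T"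
  unfolding ell2_closure_def by blast

text \<open>The parallelogram law, from the expansions at \<open>t = 1\<close> and
  \<open>t = - 1\<close>, with the nonnegative square of \<open>f - g\<close> dropped. It replaces
  the triangle inequality for squared norms.\<close>

lemma ell2_inner_add_le:
  assumes "f \<in> ell2 m" "g \<in> ell2 m"
  shows "ell2_inner m (\<lambda>x. f x + g x) (\<lambda>x. f x + g x) \<le> 2 * ell2_inner m f f + 2 * ell2_inner m g g"
proof -
  let ?w = "\<lambda>x. measure m {x}"
  have f: "f \<in> wl2 ?w" and g: "g \<in> wl2 ?w"
    using assms by (auto simp: ell2_eq_wl2)
  have w: "0 \<le> ?w x" for x
    by simp
  have fg: "(\<lambda>x. f x + t * g x) \<in> wl2 ?w" for t
    using wl2_lincomb[OF w f g, of 1 t] by simp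
  have exp: "wl2_inner ?w (\<lambda>x. f x + t * g x) (\<lambda>x. f x + t * g x) =
      wl2_inner ?w f f + 2 * t * wl2_inner ?w f g + t\<^sup>2 * wl2_inner ?w g g" for t
    using wl2_inner_lincomb[OF w f g fg[of t], of 1 t] wl2_inner_lincomb[OF w f g f, of 1 t]
      wl2_inner_lincomb[OF w f g g, of 1 t] wl2_inner_sym[of ?w f "\<lambda>x. f x + t * g x"]
      wl2_inner_sym[of ?w g "\<lambda>x. f x + t * g x"] wl2_inner_sym[of ?w g f]
    by (simp only: mult_1 power2_eq_square) (simp add: algebra_simps)
  show ?thesis
    using exp[of 1] exp[of "- 1"] wl2_inner_self_nonneg[of ?w, OF w, of "\<lambda>x. f x + (- 1) * g x"]
    by (simp add: ell2_inner_eq_wl2)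
qed

lemma ell2_closure_dense:
  assumes D: "D \<subseteq> ell2 m" and S: "S \<subseteq> ell2 m"
    and dense: "\<And>h e. h \<in> D \<Longrightarrow> 0 < e \<Longrightarrow> \<exists>s\<in>S. ell2_inner m (\<lambda>x. h x - s x) (\<lambda>x. h x - s x) < e"
  shows "ell2_closure m D \<subseteq> ell2_closure m S"
proof
  fix f assume f: "f \<in> ell2_closure m D"
  then have fl: "f \<in> ell2 m"
    by (simp add: ell2_closure_def)
  have "\<exists>s\<in>S. ell2_norm m (\<lambda>x. f x - s x) < e" if e: "0 < e" for e
  proof -
    obtain h where h: "h \<in> D" "ell2_norm m (\<lambda>x. f x - h x) < e / 2"
      using f half_gt_zero[OF e] unfolding ell2_closure_def by blast
    have fh: "ell2_inner m (\<lambda>x. f x - h x) (\<lambda>x. f x - h x) < (e / 2)\<^sup>2"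
      using h(2) e by (subst (asm) ell2_norm_less_iff) auto
    obtain s where s: "s \<in> S" and hs: "ell2_inner m (\<lambda>x. h x - s x) (\<lambda>x. h x - s x) < (e / 2)\<^sup>2"
      using dense[OF h(1), of "(e / 2)\<^sup>2"] e by auto
    have hl: "h \<in> ell2 m" and sl: "s \<in> ell2 m"
      using h(1) s D S by auto
    have "ell2_inner m (\<lambda>x. f x - s x) (\<lambda>x. f x - s x) \<le>
      2 * ell2_inner m (\<lambda>x. f x - h x) (\<lambda>x. f x - h x) + 2 * ell2_inner m (\<lambda>x. h x - s x) (\<lambda>x. h x - s x)"
      using ell2_inner_add_le[OF ell2_diff[OF fl hl] ell2_diff[OF hl sl]] by simp
    also have "\<dots> < e\<^sup>2"
      using fh hs by (simp add: power_divide)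
    finally show ?thesis
      using s e by (auto simp: ell2_norm_less_iff)
  qed
  with fl show "f \<in> ell2_closure m S"
    by (simp add: ell2_closure_def)
qed

theorem corollary3p3:
  fixes b :: "'a::countable \<Rightarrow> 'a \<Rightarrow> real" and m :: "'a measure"
  assumes "weighted_graph b"
    and "graph_connected b"
    and "global_poincare b"
    and "sets m = UNIV"
    and "prob_space m"
    and "full_support m"
  shows "pure_point_spectrum m (neumann_space b m) (neumann_dom b m) (neumann_op b m)"
proof -
  let ?D = "neumann_form_dom b m"
  interpret compact_form ?D "energy b" "ell2_inner m"
    by (rule compact_form_neumann[OF assms(1,3,4) prob_space.axioms(1)[OF assms(5)] assms(6)])
  have D: "?D \<subseteq> ell2 m"
    by (simp add: neumann_form_dom_def)
  obtain B where eig: "\<And>v. v \<in> B \<Longrightarrow> eig v"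
    and on: "\<And>v u. v \<in> B \<Longrightarrow> u \<in> B \<Longrightarrow> ell2_inner m v u = (if v = u then 1 else 0)"
    and dense: "\<And>h e. h \<in> ?D \<Longrightarrow> 0 < e \<Longrightarrow>
      \<exists>s\<in>lin_span B. ell2_inner m (\<lambda>x. h x - s x) (\<lambda>x. h x - s x) < e"
    using eigenbasis by blast
  have BD: "B \<subseteq> ?D"
    using eig by (auto simp: eig_def)
  \<comment> \<open>One inclusion is density of the span in the form domain; the other holds because
    the span lies in the form domain.\<close>
  have "ell2_closure m ?D = ell2_closure m (lin_span B)"
    using lin_span_subset[OF BD] D by (intro equalityI ell2_closure_dense ell2_closure_mono dense) auto
  then have "ell2_orthonormal_basis m (neumann_space b m) B"
    using BD subset_ell2_closure[OF D] on
    by (auto simp: ell2_orthonormal_basis_def ell2_orthonormal_def neumann_space_def)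
  moreover have "eigenvector (neumann_dom b m) (neumann_op b m) v" if v: "v \<in> B" for v
  proof -
    obtain l where vD: "v \<in> ?D" and l: "\<And>h. h \<in> ?D \<Longrightarrow> energy b v h = l * ell2_inner m v h"
      using eig[OF v] by (auto simp: eig_def)
    have "(\<lambda>x. l * v x) \<in> ell2_closure m ?D"
      using subset_ell2_closure[OF D] scaled[OF vD] by blast
    \<comment> \<open>The weak eigenvalue equation is the defining relation of the operator with
      value \<open>l * v\<close>; uniqueness of the representing function then evaluates the
      definite description.\<close>
    then have rep: "form_represents m ?D (energy b) v (\<lambda>x. l * v x)"
      using vD l by (simp add: form_represents_def p_scaled)
    have "neumann_op b m v = (\<lambda>x. l * v x)"
      unfolding neumann_op_def form_op_def
      by (rule the_equality, rule rep) (rule form_represents_unique[OF assms(6) D _ rep])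
    moreover have "v \<in> neumann_dom b m"
      using rep by (auto simp: neumann_dom_def form_op_dom_def)
    moreover have "v \<noteq> (\<lambda>x. 0)"
      using on[OF v v] by (auto simp: ell2_inner_def)
    ultimately show ?thesis
      by (auto simp: eigenvector_def)
  qed
  ultimately show ?thesis
    unfolding pure_point_spectrum_def by blast
qed

end
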